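(* Let $(\mu,\nu),(\mu',\nu')\in\mathcal{P}(\mathsf{X})\times\mathcal{P}(\mathsf{Y})$ be such that the associated entropic optimal transport problems $\mathcal{C}_1(\mu,\nu)$ and $\mathcal{C}_1(\mu',\nu')$ are finite. Let $\pi\in\Pi(\mu,\nu)$ and $\pi'\in\Pi(\mu',\nu')$ be the respective optimizers, with potentials $(\varphi,\psi)$ and $(\varphi',\psi')$, i.e. $d\pi=e^{\varphi\oplus\psi-c}d(\mu\otimes\nu)$ and $d\pi'=e^{\varphi'\oplus\psi'-c}d(\mu'\otimes\nu')$. Set $$C_1:=\inf_{\alpha>0}\frac{2}{\alpha}\Big(\frac32+\log\int e^{\alpha|\varphi'-\varphi|}d\mu\Big),\qquad C_2:=\inf_{\alpha>0}\frac{2}{\alpha}\Big(\frac32+\log\int e^{\alpha|\psi'-\psi|}d\nu\Big).$$ Then $$H(\pi'|\pi)+H(\pi|\pi')\le C_1\sqrt{H(\mu'|\mu)}+(1+C_1/2)H(\mu'|\mu)+H(\mu|\mu')+C_2\sqrt{H(\nu'|\nu)}+(1+C_2/2)H(\nu'|\nu)+H(\nu|\nu').$$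
   Context: $\mathsf{X},\mathsf{Y}$ are Polish spaces, $c:\mathsf{X}\times\mathsf{Y}\to\mathbb{R}$ is measurable with $e^{-c}\in L^1(\mu\otimes\nu)$ (and likewise for $\mu'\otimes\nu'$). For marginals $(\mu,\nu)$, the entropic optimal transport problem is $\mathcal{C}_1(\mu,\nu):=\inf_{\pi\in\Pi(\mu,\nu)}\int c\,d\pi+H(\pi|\mu\otimes\nu)$, where $\Pi(\mu,\nu)$ is the set of couplings of $\mu,\nu$ and $H(\rho|\sigma)=\int\log\frac{d\rho}{d\sigma}d\rho$ if $\rho\ll\sigma$, $+\infty$ otherwise. When finite, it has a unique minimizer $\pi$, and $d\pi=e^{\varphi\oplus\psi-c}d(\mu\otimes\nu)$ for measurable "potentials" $\varphi:\mathsf{X}\to\mathbb{R}$, $\psi:\mathsf{Y}\to\mathbb{R}$, where $(\varphi\oplus\psi)(x,y)=\varphi(x)+\psi(y)$. Conventions: the right-hand side is interpreted in $[0,\infty]$. *)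

theory Defs
  imports "HOL-Probability.Probability"
begin

definition ereal_integral :: "'a measure \<Rightarrow> ('a \<Rightarrow> real) \<Rightarrow> ereal" where
  "ereal_integral M f =
     enn2ereal (\<integral>\<^sup>+ x. ennreal (f x) \<partial>M) - enn2ereal (\<integral>\<^sup>+ x. ennreal (- f x) \<partial>M)"

definition rel_entropy :: "'a measure \<Rightarrow> 'a measure \<Rightarrow> ereal" where
  "rel_entropy \<rho> \<sigma> =
     (if sets \<rho> = sets \<sigma> \<and> absolutely_continuous \<sigma> \<rho>
      then ereal_integral \<rho> (\<lambda>x. ln (enn2real (RN_deriv \<sigma> \<rho> x)))
      else \<infinity>)"

definition couplings :: "'a measure \<Rightarrow> 'b measure \<Rightarrow> ('a \<times> 'b) measure set" where
  "couplings \<mu> \<nu> = {\<pi>. sets \<pi> = sets (\<mu> \<Otimes>\<^sub>M \<nu>) \<and> prob_space \<pi> \<and>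
                        distr \<pi> \<mu> fst = \<mu> \<and> distr \<pi> \<nu> snd = \<nu>}"

definition eot_cost :: "('a \<times> 'b \<Rightarrow> real) \<Rightarrow> 'a measure \<Rightarrow> 'b measure \<Rightarrow> ereal" where
  "eot_cost c \<mu> \<nu> =
     (INF \<pi>\<in>couplings \<mu> \<nu>. ereal_integral \<pi> c + rel_entropy \<pi> (\<mu> \<Otimes>\<^sub>M \<nu>))"

definition ln_enn :: "ennreal \<Rightarrow> ereal" where
  "ln_enn x = (if x = \<infinity> then \<infinity> else ereal (ln (enn2real x)))"

definition sqrt_ereal :: "ereal \<Rightarrow> ereal" where
  "sqrt_ereal x = (if x = \<infinity> then \<infinity> else ereal (sqrt (real_of_ereal x)))"

definition stab_const :: "'a measure \<Rightarrow> ('a \<Rightarrow> real) \<Rightarrow> ereal" where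
  "stab_const M f =
     (INF \<alpha>\<in>{0<..}. ereal (2 / \<alpha>) *
        (ereal (3/2) + ln_enn (\<integral>\<^sup>+ x. ennreal (exp (\<alpha> * \<bar>f x\<bar>)) \<partial>M)))"

end

theory Submission
  imports Defs "HOL-Real_Asymp.Real_Asymp"
begin

text \<open>
  Write \<open>d\<pi>'/d\<pi> = exp (F \<oplus> G)\<close>, where \<open>F = \<phi>' - \<phi> + ln (d\<mu>'/d\<mu>)\<close> and similarly for \<open>G\<close>. The symmetrised
  entropy is the integral of the nonnegative function \<open>(F \<oplus> G) (exp (F \<oplus> G) - 1)\<close> against \<open>\<pi>\<close>.
  Since \<open>F\<close> and \<open>G\<close> need not be integrable separately, both are clipped to \<open>[-n, n]\<close>. Clipping is
  odd and monotone, so the integrand stays nonnegative; the clipped integral splits into integrals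
  against \<open>\<mu>' - \<mu>\<close> and \<open>\<nu>' - \<nu>\<close>, and Fatou's lemma bounds the entropy by the limit. In the limit,
  \<open>ln (d\<mu>'/d\<mu>)\<close> contributes \<open>H(\<mu>'|\<mu>) + H(\<mu>|\<mu>')\<close> and \<open>\<phi>' - \<phi>\<close> is controlled by the weighted Pinsker
  inequality of Bolley and Villani.
\<close>

section \<open>Pointwise inequalities for the entropy integrand\<close>

text \<open>The constant is exactly what \<open>square_le_entropy\<close> needs at its right
  endpoint: at 5 that inequality amounts to \<open>32 \<le> 20 * ln 5\<close>.\<close>

lemma ln_5_ge: "8 / 5 \<le> ln (5 :: real)"
proof -
  have "exp (8 :: real) = exp 1 ^ 8"
    by (simp flip: exp_of_nat_mult)
  also have "\<dots> \<le> (272 / 100) ^ 8"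
    using e_less_272 by (intro power_mono) auto
  also have "\<dots> \<le> 5 ^ 5"
    by (simp add: power_divide)
  finally have "8 \<le> ln ((5 :: real) ^ 5)"
    by (subst ln_ge_iff) auto
  then show ?thesis
    by (simp only: ln_realpow)
qed

text \<open>The difference \<open>q\<close> of the two sides vanishes at 1 together with its
  derivative. The sign of the derivative settles the range up to 2; from 2 on \<open>q\<close> is
  concave, so only its values at 2 and 5 matter.\<close>

lemma square_le_entropy:
  fixes h :: real
  assumes "0 \<le> h" "h \<le> 5"
  shows "(h - 1)\<^sup>2 \<le> 4 * (h * ln h - h + 1)"
proof -
  define q where "q = (\<lambda>h::real. 4 * (h * ln h - h + 1) - (h - 1)\<^sup>2)"
  have D: "(q has_real_derivative 4 * ln x - 2 * (x - 1)) (at x)" if "0 < x" for x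
    unfolding q_def using that by (auto intro!: derivative_eq_intros)
  have D2: "((\<lambda>x. 4 * ln x - 2 * (x - 1)) has_real_derivative 4 / x - 2) (at x)"
    if "0 < x" for x :: real
    using that by (auto intro!: derivative_eq_intros)
  consider "h = 0" | "0 < h" "h \<le> 1" | "1 \<le> h" "h \<le> 2" | "2 \<le> h"
    using assms by linarith
  then have "0 \<le> q h"
  proof cases
    case 1
    then show ?thesis by (simp add: q_def)
  next
    case 2
    have "4 * ln x - 2 * (x - 1) \<le> 0" if "h \<le> x" "x \<le> 1" for x
      using ln_le_minus_one[of x] that 2 by auto
    then have "q 1 \<le> q h"
      using 2 D by (intro DERIV_nonpos_imp_nonincreasing[of h 1 q]) (auto intro!: exI D)
    then show ?thesis by (simp add: q_def)
  next
    case 3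
    have "0 \<le> 4 * ln x - 2 * (x - 1)" if "1 \<le> x" "x \<le> h" for x
    proof -
      \<comment> \<open>Up to 2 the elementary bound \<open>1 - inverse x \<le> ln x\<close> is
        strong enough, and this product expresses that.\<close>
      have "0 \<le> (x - 1) * (2 - x)"
        using that 3 by simp
      then have "2 * (x - 1) \<le> 4 * (1 - inverse x)"
        using that by (simp add: field_simps)
      also have "\<dots> \<le> 4 * ln x"
        using ln_le_minus_one[of "inverse x"] that by (simp add: ln_inverse)
      finally show ?thesis by simp
    qed
    then have "q 1 \<le> q h"
      using 3 D by (intro DERIV_nonneg_imp_nondecreasing[of 1 h q]) (auto intro!: exI D)
    then show ?thesis by (simp add: q_def)
  next
    case 4
    have "concave_on {2..5} q"
      using D D2 by (intro f''_le0_imp_concave[where f' = "\<lambda>x. 4 * ln x - 2 * (x - 1)"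
            and f'' = "\<lambda>x. 4 / x - 2"]) (auto simp: field_simps)
    then have "(q 5 - q 2) / (5 - 2) * (h - 2) + q 2 \<le> q h"
      using concave_onD_Icc'[of 2 5 q h] 4 assms by auto
    moreover have "0 \<le> q 2"
      using ln2_ge_two_thirds by (simp add: q_def)
    moreover have "0 \<le> q 5"
      using ln_5_ge by (simp add: q_def)
    moreover have "(q 5 - q 2) / (5 - 2) * (h - 2) + q 2 = (q 5 * (h - 2) + q 2 * (5 - h)) / 3"
      by (simp add: field_simps)
    ultimately show ?thesis
      using 4 assms by (smt (verit) divide_nonneg_pos mult_nonneg_nonneg)
  qed
  then show ?thesis by (simp add: q_def)
qed

text \<open>For the first bound, \<open>ln h\<close> is compared with \<open>ln 5\<close> by
  \<open>ln y \<le> y - 1\<close> at \<open>y = 5 / h\<close>; with \<open>8 / 5 \<le> ln 5\<close>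
  the result suffices exactly from 5 on. For the second, \<open>g\<close> is convex on this range,
  so it is enough to check \<open>g\<close> and \<open>g'\<close> at 5. The factor 3/2 reappears as
  the coefficient of \<open>H / 2\<close> in \<open>weighted_Pinsker\<close>.\<close>

lemma entropy_large:
  fixes h :: real
  assumes "5 \<le> h"
  shows "h - 1 \<le> h * ln h - h + 1"
    and "(h - 1) * ln (h - 1) \<le> 3 / 2 * (h * ln h - h + 1)"
proof -
  have "ln 5 - ln h \<le> 5 / h - 1"
    using assms ln_le_minus_one[of "5 / h"] by (simp add: ln_div)
  then have "h * (13 / 5 - 5 / h) \<le> h * ln h"
    using assms ln_5_ge by (intro mult_left_mono) auto
  then show "h - 1 \<le> h * ln h - h + 1"
    using assms by (simp add: right_diff_distrib)
  define g where "g = (\<lambda>h::real. 3 / 2 * (h * ln h - h + 1) - (h - 1) * ln (h - 1))"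
  define g' where "g' = (\<lambda>h::real. 3 / 2 * ln h - ln (h - 1) - 1)"
  have ln_4: "ln (4 :: real) = 2 * ln 2"
    using ln_realpow[of 2 2] by simp
  have D: "(g has_real_derivative g' x) (at x)" if "5 \<le> x" for x
  proof -
    have "(g has_real_derivative
        3 / 2 * ((ln x + x * (1 / x)) - 1) - (ln (x - 1) + (x - 1) * (1 / (x - 1)))) (at x)"
      unfolding g_def using that by (auto intro!: derivative_eq_intros)
    then show ?thesis
      using that by (simp add: g'_def algebra_simps)
  qed
  have D': "(g' has_real_derivative 3 / (2 * x) - 1 / (x - 1)) (at x)" if "5 \<le> x" for x
    unfolding g'_def using that by (auto intro!: derivative_eq_intros simp: field_simps)
  have "g' 5 \<le> g' x" if "5 \<le> x" for x
  proof (rule DERIV_nonneg_imp_nondecreasing[OF that])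
    fix y :: real assume "5 \<le> y"
    then show "\<exists>z. (g' has_real_derivative z) (at y) \<and> 0 \<le> z"
      using D'[of y] by (intro exI[of _ "3 / (2 * y) - 1 / (y - 1)"]) (auto simp: field_simps)
  qed
  moreover have "0 \<le> g' 5"
    using ln_5_ge ln2_le_25_over_36 by (simp add: g'_def ln_4)
  ultimately have "g 5 \<le> g h"
    using D by (intro DERIV_nonneg_imp_nondecreasing[OF assms]) (meson order_trans)
  moreover have "0 \<le> g 5"
    using ln_5_ge ln2_le_25_over_36 by (simp add: g_def ln_4)
  ultimately have "0 \<le> g h"
    by linarith
  then show "(h - 1) * ln (h - 1) \<le> 3 / 2 * (h * ln h - h + 1)"
    by (simp add: g_def)
qed

text \<open>The square of \<open>ln y\<close> is concave for \<open>y\<close> at least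
  \<open>exp 1\<close>, so it lies below its tangent at \<open>y = exp S\<close>; the inequality is
  this fact at \<open>y = exp s\<close>. It serves as a pointwise form of Jensen's inequality,
  linear in the exponential and hence easy to integrate.\<close>

lemma square_le_exp_tangent:
  fixes s S :: real
  assumes "1 \<le> s" "1 \<le> S"
  shows "s\<^sup>2 \<le> S\<^sup>2 + 2 * S * (exp (s - S) - 1)"
proof -
  define d where "d = s - S"
  have "d\<^sup>2 \<le> 2 * S * (exp d - 1 - d)"
  proof (cases "0 \<le> d")
    case True
    have "1 * (exp d - 1 - d) \<le> S * (exp d - 1 - d)"
      using assms exp_ge_add_one_self[of d] by (intro mult_right_mono) linarith+
    then show ?thesis
      using exp_lower_Taylor_quadratic[OF True] by simp
  next
    case False
    \<comment> \<open>With \<open>x = - d\<close>, nonnegativity of \<open>r\<close> is the claim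
      for the smallest possible \<open>S\<close>, namely \<open>1 - d\<close>, divided by
      \<open>2 * (1 - d)\<close>. That \<open>S\<close> is at least \<open>1 - d\<close> is the
      hypothesis \<open>1 \<le> s\<close>.\<close>
    define r where "r = (\<lambda>x::real. exp (- x) - 1 + x - x\<^sup>2 / (2 * (1 + x)))"
    have D: "(r has_real_derivative 1 - exp (- x) - (2 * x + x\<^sup>2) / (2 * (1 + x)\<^sup>2)) (at x)"
      if "0 \<le> x" for x
    proof -
      have "(r has_real_derivative - exp (- x) + 1
          - (2 * x * (2 * (1 + x)) - x\<^sup>2 * 2) / ((2 * (1 + x)) * (2 * (1 + x)))) (at x)"
        unfolding r_def using that by (auto intro!: derivative_eq_intros)
      also have "(2 * x * (2 * (1 + x)) - x\<^sup>2 * 2) / ((2 * (1 + x)) * (2 * (1 + x)))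
          = (2 * (2 * x + x\<^sup>2)) / (2 * (2 * (1 + x)\<^sup>2))"
        by (rule arg_cong2[of _ _ _ _ "(/)"]) (simp_all add: power2_eq_square algebra_simps)
      finally show ?thesis
        by (simp only: mult_divide_mult_cancel_left_if) simp
    qed
    have "r 0 \<le> r (- d)"
    proof (rule DERIV_nonneg_imp_nondecreasing[of 0 "- d" r])
      fix x :: real assume x: "0 \<le> x"
      have "exp (- x) \<le> 1 / (1 + x)"
        using exp_ge_add_one_self[of x] x by (simp add: exp_minus field_simps)
      moreover have "(2 * x + x\<^sup>2) / (2 * (1 + x)\<^sup>2) \<le> 1 - 1 / (1 + x)"
        using x by (simp add: divide_simps power2_eq_square) (simp add: algebra_simps)
      ultimately show "\<exists>y. (r has_real_derivative y) (at x) \<and> 0 \<le> y"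
        using D[OF x] by force
    qed (use False in simp)
    then have "d\<^sup>2 \<le> 2 * (1 - d) * (exp d - 1 - d)"
      using False by (simp add: r_def field_simps)
    moreover have "1 - d \<le> S"
      using assms by (simp add: d_def)
    then have "2 * (1 - d) * (exp d - 1 - d) \<le> 2 * S * (exp d - 1 - d)"
      by (intro mult_right_mono) (simp_all add: le_diff_eq exp_ge_add_one_self add.commute)
    ultimately show ?thesis
      by linarith
  qed
  moreover have "s\<^sup>2 = S\<^sup>2 + 2 * S * d + d\<^sup>2"
    by (simp add: d_def power2_eq_square algebra_simps)
  ultimately show ?thesis
    by (simp add: d_def algebra_simps)
qed

text \<open>Young's inequality for the convex conjugates \<open>u * ln u - u\<close> and
  \<open>exp s\<close>: the bound \<open>1 + y \<le> exp y\<close> at \<open>y = s - ln u\<close>,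
  multiplied by \<open>u\<close>. The case \<open>s = 0\<close> gives the nonnegativity of the
  entropy integrand.\<close>

lemma mult_le_entropy_exp:
  fixes s u :: real
  assumes "0 \<le> u"
  shows "s * u \<le> u * ln u - u + exp s"
proof (cases "u = 0")
  case False
  then have "0 < u" using assms by simp
  have "u * (1 + (s - ln u)) \<le> u * exp (s - ln u)"
    using assms exp_ge_add_one_self by (intro mult_left_mono)
  also have "u * exp (s - ln u) = exp s"
    using \<open>0 < u\<close> by (simp add: exp_diff)
  finally show ?thesis by (simp add: algebra_simps)
qed simp

text \<open>Absorbs the term \<open>- (m * ln m)\<close> that the shift \<open>T\<close> creates in
  \<open>weighted_Pinsker\<close>. It amounts to \<open>ln s \<le> s / 2\<close> at
  \<open>s = 1 / sqrt m\<close>.\<close>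

lemma neg_mult_ln_le_sqrt:
  fixes m :: real
  assumes "0 < m"
  shows "- (m * ln m) \<le> sqrt m"
proof -
  define s where "s = 1 / sqrt m"
  have "ln s \<le> s / 2"
    using ln_le_minus_one[of "s / 2"] ln2_le_25_over_36 assms by (simp add: s_def ln_div ln_mult)
  moreover have "ln m = - 2 * ln s"
    using assms by (simp add: s_def ln_div ln_sqrt)
  ultimately have "- ln m \<le> s"
    by simp
  then have "m * (- ln m) \<le> m * s"
    using assms by (intro mult_left_mono) auto
  also have "m * s = sqrt m"
    using assms by (simp add: s_def real_div_sqrt)
  finally show ?thesis by simp
qed

section \<open>The weighted Pinsker inequality\<close>

text \<open>The integral is split at \<open>h = 5\<close>. Below, AM-GM pairs the square of
  \<open>\<phi>\<close> with that of \<open>h - 1\<close>, which the entropy integrand controls, and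
  yields \<open>(1 + L) * sqrt H\<close>. Above, Young's inequality yields
  \<open>sqrt H / 2 + (3 / 2 + L) * H / 2\<close>. The two add up to the stated bound, where
  \<open>H\<close> is the relative entropy of the measure with density \<open>h\<close>.\<close>

lemma weighted_Pinsker:
  fixes h \<phi> :: "'a \<Rightarrow> real"
  assumes "prob_space M"
    and [measurable]: "h \<in> borel_measurable M" "\<phi> \<in> borel_measurable M"
    and h_nonneg: "\<And>x. 0 \<le> h x" and phi_nonneg: "\<And>x. 0 \<le> \<phi> x"
    and int_h: "integrable M h" "(\<integral>x. h x \<partial>M) = 1"
    and int_ent: "integrable M (\<lambda>x. h x * ln (h x))"
    and int_exp: "integrable M (\<lambda>x. exp (2 * \<phi> x))"
  defines "H \<equiv> \<integral>x. h x * ln (h x) \<partial>M"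
  shows "integrable M (\<lambda>x. \<phi> x * \<bar>h x - 1\<bar>)"
    and "(\<integral>x. \<phi> x * \<bar>h x - 1\<bar> \<partial>M)
         \<le> (3 / 2 + ln (\<integral>x. exp (2 * \<phi> x) \<partial>M)) * (sqrt H + H / 2)"
proof -
  interpret prob_space M by fact
  \<comment> \<open>Since \<open>h\<close> has integral 1, \<open>k\<close> has the same integral as
    \<open>h * ln (h)\<close>, but it is nonnegative pointwise.\<close>
  define k where "k = (\<lambda>x. h x * ln (h x) - h x + 1)"
  define E where "E = (\<integral>x. exp (2 * \<phi> x) \<partial>M)"
  define L where "L = ln E"
  have k_nonneg: "0 \<le> k x" for x
    using mult_le_entropy_exp[OF h_nonneg, of 0 x] by (simp add: k_def)
  have int_k: "integrable M k" "(\<integral>x. k x \<partial>M) = H"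
    using int_h int_ent by (simp_all add: k_def H_def prob_space)
  have H_nonneg: "0 \<le> H"
    using k_nonneg by (simp flip: int_k(2))
  have "(\<integral>x. 1 \<partial>M) \<le> E"
    unfolding E_def using int_exp phi_nonneg by (intro integral_mono) auto
  then have E: "1 \<le> E"
    by (simp add: prob_space)
  then have L: "0 \<le> L" "exp (s - L) = exp s / E" for s
    by (simp_all add: L_def exp_diff)
  have "integrable M (\<lambda>x. \<phi> x * \<bar>h x - 1\<bar>) \<and>
      (\<integral>x. \<phi> x * \<bar>h x - 1\<bar> \<partial>M) \<le> (3 / 2 + L) * (sqrt H + H / 2)"
  \<comment> \<open>The weight \<open>t\<close> below must be positive, so \<open>H = 0\<close> is
    treated apart: then \<open>k\<close> vanishes almost everywhere, which forces
    \<open>h = 1\<close>.\<close>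
  proof (cases "H = 0")
    case True
    have "AE x in M. k x = 0"
      using int_k k_nonneg integral_nonneg_eq_0_iff_AE[of M k] True by simp
    then have "AE x in M. \<phi> x * \<bar>h x - 1\<bar> = 0"
    proof (rule AE_mp, intro AE_I2 impI)
      fix x assume "k x = 0"
      then have "h x = 1"
        using square_le_entropy[OF h_nonneg, of x] entropy_large(1)[of "h x"]
        by (cases "h x \<le> 5") (auto simp: k_def)
      then show "\<phi> x * \<bar>h x - 1\<bar> = 0" by simp
    qed
    then show ?thesis
      using True by (simp add: integrable_cong_AE[where g = "\<lambda>_. 0"] integral_cong_AE[where g = "\<lambda>_. 0"])
  next
    case False
    then have "0 < H" using H_nonneg by simp
    define A where "A = {x \<in> space M. 5 \<le> h x}"
    define v where "v = (\<lambda>x. indicator A x * (h x - 1))"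
    define m where "m = (\<integral>x. v x \<partial>M)"
    have [measurable]: "A \<in> sets M"
      by (simp add: A_def)
    have [measurable]: "v \<in> borel_measurable M" "k \<in> borel_measurable M"
      by (simp_all add: v_def k_def)
    have v: "0 \<le> v x" "v x \<le> k x" for x
      using entropy_large(1)[of "h x"] k_nonneg[of x]
      by (auto simp: v_def A_def k_def indicator_def)
    have int_v: "integrable M v"
      using v by (intro Bochner_Integration.integrable_bound[OF int_k(1)]) (auto intro!: AE_I2 order_trans[OF _ abs_ge_self])
    have "m \<le> H"
      unfolding m_def int_k(2)[symmetric] using v int_v int_k by (intro integral_mono) auto
    have large: "integrable M (\<lambda>x. \<phi> x * v x) \<and>
        (\<integral>x. \<phi> x * v x \<partial>M) \<le> sqrt H / 2 + (3 / 2 + L) * H / 2"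
    proof (cases "m = 0")
      case True
      have "AE x in M. v x = 0"
        using int_v v integral_nonneg_eq_0_iff_AE[of M v] True by (simp add: m_def)
      then have "AE x in M. \<phi> x * v x = 0"
        by eventually_elim simp
      then show ?thesis
        using H_nonneg L
        by (simp add: integrable_cong_AE[where g = "\<lambda>_. 0"] integral_cong_AE[where g = "\<lambda>_. 0"])
    next
      case False
      then have "0 < m"
        using v by (simp add: m_def order_less_le)
      \<comment> \<open>The shift minimising the integrated Young inequality for \<open>2 \<phi> - T\<close> and \<open>h - 1\<close> on \<open>{h \<ge> 5}\<close>.\<close>
      define T where "T = L - ln m"
      define B where "B = (\<lambda>x. ((T - 1) * v x + 3 / 2 * k x + m / E * exp (2 * \<phi> x)) / 2)"
      have int_B: "integrable M B"
        using int_v int_k int_exp by (simp add: B_def)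
      have exp_T: "exp (s - T) = m / E * exp s" for s
        using \<open>0 < m\<close> E by (simp add: T_def L_def exp_diff exp_add field_simps)
      \<comment> \<open>Young's inequality for \<open>2 * \<phi> x - T\<close> and
        \<open>v x\<close>, with \<open>v x * ln (v x)\<close> replaced by its bound
        \<open>3 / 2 * k x\<close>, solved for the product and halved.\<close>
      have le_B: "\<phi> x * v x \<le> B x" for x
      proof (cases "x \<in> A")
        case True
        then have "v x = h x - 1" "5 \<le> h x"
          by (simp_all add: v_def A_def)
        then have "(2 * \<phi> x - T) * v x \<le> 3 / 2 * k x - v x + m / E * exp (2 * \<phi> x)"
          using mult_le_entropy_exp[of "v x" "2 * \<phi> x - T"] entropy_large(2)[of "h x"]
          unfolding exp_T k_def \<open>v x = h x - 1\<close> by linarith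
        then show ?thesis
          by (simp add: B_def algebra_simps)
      next
        case False
        then show ?thesis
          using k_nonneg[of x] E \<open>0 < m\<close> by (simp add: B_def v_def)
      qed
      have int: "integrable M (\<lambda>x. \<phi> x * v x)"
        using le_B phi_nonneg v
        by (intro Bochner_Integration.integrable_bound[OF int_B]) (auto intro!: AE_I2 order_trans[OF _ abs_ge_self])
      have "(\<integral>x. \<phi> x * v x \<partial>M) \<le> (\<integral>x. B x \<partial>M)"
        using int int_B le_B by (intro integral_mono) auto
      also have "\<dots> = ((T - 1) * m + 3 / 2 * H + m) / 2"
        using int_v int_k int_exp E by (simp add: B_def m_def E_def[symmetric])
      also have "\<dots> = L * m / 2 + - (m * ln m) / 2 + 3 / 4 * H"
        by (simp add: T_def field_simps)
      \<comment> \<open>The unknown mass \<open>m\<close> is eliminated through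
        \<open>m \<le> H\<close>. As \<open>- (m * ln m)\<close> is not monotone in
        \<open>m\<close>, it is first bounded by \<open>sqrt m\<close>.\<close>
      also have "\<dots> \<le> L * H / 2 + sqrt H / 2 + 3 / 4 * H"
      proof -
        have "- (m * ln m) \<le> sqrt H"
          using neg_mult_ln_le_sqrt[OF \<open>0 < m\<close>] \<open>m \<le> H\<close> by (meson order_trans real_sqrt_le_mono)
        moreover have "L * m \<le> L * H"
          using L \<open>m \<le> H\<close> by (intro mult_left_mono)
        ultimately show ?thesis by simp
      qed
      finally show ?thesis
        using int by (simp add: field_simps)
    qed
    define S where "S = 1 + L"
    \<comment> \<open>The weight balancing the two halves of the estimate of \<open>\<phi> \<bar>h - 1\<bar>\<close> by AM-GM on \<open>{h < 5}\<close>.\<close>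
    define t where "t = sqrt H / S"
    \<comment> \<open>The factor of \<open>t\<close> is the tangent bound for the square of
      \<open>1 + 2 * \<phi> x\<close>; it integrates to the square of \<open>S\<close>, because
      \<open>exp (2 * \<phi> x) / E\<close> has integral 1. The added 1 provides the hypothesis
      \<open>1 \<le> s\<close> of \<open>square_le_exp_tangent\<close>.\<close>
    define B where "B = (\<lambda>x. (t * (S\<^sup>2 + 2 * S * (exp (2 * \<phi> x) / E - 1)) + k x / t) / 2)"
    have "1 \<le> S" "0 < t"
      using L \<open>0 < H\<close> by (auto simp: S_def t_def)
    have int_B: "integrable M B"
      using int_k int_exp by (simp add: B_def)
    have le_B: "\<phi> x * \<bar>h x - 1\<bar> \<le> B x + \<phi> x * v x" if "x \<in> space M" for x
    proof (cases "5 \<le> h x")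
      case True
      \<comment> \<open>Here \<open>\<phi> x * v x\<close> already equals the left-hand side, so
        only \<open>0 \<le> B x\<close> remains; the tangent bound dominates a square.\<close>
      have "0 \<le> S\<^sup>2 + 2 * S * (exp (2 * \<phi> x - L) - 1)"
        using square_le_exp_tangent[OF _ \<open>1 \<le> S\<close>, of "1 + 2 * \<phi> x"] phi_nonneg[of x]
        by (simp add: S_def) (smt (verit) zero_le_power2)
      then have "0 \<le> B x"
        using k_nonneg[of x] \<open>0 < t\<close> by (simp add: B_def L(2))
      then show ?thesis
        using True that by (simp add: v_def A_def)
    next
      case False
      define a where "a = 2 * \<phi> x"
      define b where "b = \<bar>h x - 1\<bar> / 2"
      have "0 \<le> (t * a - b)\<^sup>2"
        by simp
      then have "a * b \<le> (t * a\<^sup>2 + b\<^sup>2 / t) / 2"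
        using \<open>0 < t\<close> by (simp add: power2_eq_square field_simps)
      moreover have "b\<^sup>2 \<le> k x"
        using square_le_entropy[OF h_nonneg, of x] False by (simp add: b_def k_def power_divide)
      moreover have "a\<^sup>2 \<le> S\<^sup>2 + 2 * S * (exp (2 * \<phi> x) / E - 1)"
      proof -
        have "a\<^sup>2 \<le> (1 + a)\<^sup>2"
          using phi_nonneg[of x] by (intro power_mono) (auto simp: a_def)
        also have "\<dots> \<le> S\<^sup>2 + 2 * S * (exp (1 + a - S) - 1)"
          using phi_nonneg[of x] \<open>1 \<le> S\<close> by (intro square_le_exp_tangent) (auto simp: a_def)
        finally show ?thesis
          by (simp add: S_def a_def L(2))
      qed
      ultimately have "a * b \<le> B x"
        using \<open>0 < t\<close> unfolding B_def
        by (smt (verit) divide_right_mono mult_left_mono)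
      then show ?thesis
        using False that by (simp add: v_def A_def a_def b_def)
    qed
    have int: "integrable M (\<lambda>x. \<phi> x * \<bar>h x - 1\<bar>)"
    proof (rule Bochner_Integration.integrable_bound)
      show "integrable M (\<lambda>x. B x + \<phi> x * v x)"
        using int_B large by simp
      show "AE x in M. norm (\<phi> x * \<bar>h x - 1\<bar>) \<le> norm (B x + \<phi> x * v x)"
        using le_B phi_nonneg by (intro AE_I2) (simp add: abs_mult order_trans[OF _ abs_ge_self])
    qed simp
    have "(\<integral>x. \<phi> x * \<bar>h x - 1\<bar> \<partial>M) \<le> (\<integral>x. B x + \<phi> x * v x \<partial>M)"
      using int int_B le_B large by (intro integral_mono) auto
    also have "\<dots> = (t * S\<^sup>2 + H / t) / 2 + (\<integral>x. \<phi> x * v x \<partial>M)"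
      using int_B int_k int_exp large E by (simp add: B_def E_def[symmetric] prob_space)
    also have "t * S\<^sup>2 = S * sqrt H"
      using \<open>1 \<le> S\<close> by (simp add: t_def power2_eq_square)
    also have "H / t = S * sqrt H"
      using \<open>1 \<le> S\<close> \<open>0 < H\<close> by (simp add: t_def field_simps)
    finally show ?thesis
      using int large by (simp add: S_def field_simps)
  qed
  then show "integrable M (\<lambda>x. \<phi> x * \<bar>h x - 1\<bar>)"
    and "(\<integral>x. \<phi> x * \<bar>h x - 1\<bar> \<partial>M)
         \<le> (3 / 2 + ln (\<integral>x. exp (2 * \<phi> x) \<partial>M)) * (sqrt H + H / 2)"
    by (auto simp: L_def E_def)
qed

section \<open>Relative entropy\<close>

text \<open>In \<open>ereal\<close> the difference \<open>\<infinity> - \<infinity>\<close> is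
  \<open>\<infinity>\<close>, so a finite value forces both the positive and the negative part to be
  finite.\<close>

lemma ereal_integral_finite:
  assumes [measurable]: "f \<in> borel_measurable M"
    and fin: "\<bar>ereal_integral M f\<bar> \<noteq> \<infinity>"
  shows "integrable M f" "ereal_integral M f = ereal (\<integral>x. f x \<partial>M)"
proof -
  define P where "P = (\<integral>\<^sup>+ x. ennreal (f x) \<partial>M)"
  define N where "N = (\<integral>\<^sup>+ x. ennreal (- f x) \<partial>M)"
  have "P \<noteq> \<infinity>" "N \<noteq> \<infinity>"
    using fin by (cases P; cases N; auto simp: ereal_integral_def P_def[symmetric] N_def[symmetric])+
  then show int: "integrable M f"
    by (simp add: real_integrable_def P_def N_def)
  show "ereal_integral M f = ereal (\<integral>x. f x \<partial>M)"
    using \<open>P \<noteq> \<infinity>\<close> \<open>N \<noteq> \<infinity>\<close> unfolding real_lebesgue_integral_def[OF int] ereal_integral_def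
      P_def[symmetric] N_def[symmetric]
    by (cases P; cases N) auto
qed

text \<open>Integrates \<open>0 \<le> D * ln D - D + 1\<close>. As \<open>ln D\<close> need not be
  integrable, its positive and negative parts stay on opposite sides as integrals in
  \<open>ennreal\<close>, and the two unit masses then cancel.\<close>

lemma rel_entropy_nonneg:
  assumes "prob_space M" "prob_space N"
  shows "0 \<le> rel_entropy N M"
proof (cases "sets N = sets M \<and> absolutely_continuous M N")
  case True
  interpret M: prob_space M by fact
  interpret N: prob_space N by fact
  define D where "D = (\<lambda>x. enn2real (RN_deriv M N x))"
  have [measurable]: "D \<in> borel_measurable M"
    by (simp add: D_def)
  have "AE x in M. RN_deriv M N x \<noteq> \<infinity>"
    using True N.sigma_finite_measure_axioms by (intro M.RN_deriv_finite) auto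
  then have "AE x in M. RN_deriv M N x = ennreal (D x)"
    by eventually_elim (simp add: D_def less_top)
  then have "density M (RN_deriv M N) = density M (\<lambda>x. ennreal (D x))"
    by (intro density_cong) auto
  then have N_eq: "N = density M (\<lambda>x. ennreal (D x))"
    using True M.density_RN_deriv[of N] by simp
  define P where "P = (\<integral>\<^sup>+ x. ennreal (ln (D x)) \<partial>N)"
  define Q where "Q = (\<integral>\<^sup>+ x. ennreal (- ln (D x)) \<partial>N)"
  have D_nonneg: "0 \<le> D x" for x
    by (simp add: D_def)
  have "(\<integral>\<^sup>+ x. ennreal (D x) \<partial>M) = emeasure N (space N)"
    by (simp add: N_eq emeasure_density cong: nn_integral_cong)
  then have int_D: "(\<integral>\<^sup>+ x. ennreal (D x) \<partial>M) = 1"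
    by (simp add: N.emeasure_space_1)
  have "Q + 1 = (\<integral>\<^sup>+ x. ennreal (D x) * ennreal (- ln (D x)) + ennreal (D x) \<partial>M)"
    by (simp add: Q_def N_eq nn_integral_density nn_integral_add int_D)
  also have "\<dots> \<le> (\<integral>\<^sup>+ x. ennreal (D x) * ennreal (ln (D x)) + 1 \<partial>M)"
  proof (intro nn_integral_mono)
    fix x
    have *: "D x * max 0 (- ln (D x)) + D x \<le> D x * max 0 (ln (D x)) + 1"
      using mult_le_entropy_exp[OF D_nonneg, of 0 x] D_nonneg[of x] by (cases "0 \<le> ln (D x)") (auto simp: max_def)
    have "ennreal (D x) * ennreal (- ln (D x)) + ennreal (D x) = ennreal (D x * max 0 (- ln (D x)) + D x)"
      using D_nonneg[of x] by (simp add: ennreal_mult ennreal_plus max_def ennreal_neg)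
    also have "\<dots> \<le> ennreal (D x * max 0 (ln (D x)) + 1)"
      using * by (rule ennreal_leI)
    also have "\<dots> = ennreal (D x) * ennreal (ln (D x)) + 1"
      using D_nonneg[of x] by (simp add: ennreal_mult ennreal_plus max_def ennreal_neg)
    finally show "ennreal (D x) * ennreal (- ln (D x)) + ennreal (D x) \<le> ennreal (D x) * ennreal (ln (D x)) + 1" .
  qed
  also have "\<dots> = P + 1"
    by (simp add: P_def N_eq nn_integral_density nn_integral_add M.emeasure_space_1)
  finally have "Q \<le> P"
    by simp
  then have "enn2ereal Q \<le> enn2ereal P"
    by (simp add: less_eq_ennreal.rep_eq)
  then have "0 \<le> enn2ereal P - enn2ereal Q"
    by (cases P; cases Q) auto
  then show ?thesis
    using True by (simp add: rel_entropy_def ereal_integral_def P_def Q_def D_def)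
qed (auto simp: rel_entropy_def)

lemma density_exp_cancel:
  assumes [measurable]: "a \<in> borel_measurable M"
  shows "density (density M (\<lambda>x. ennreal (exp (a x)))) (\<lambda>x. ennreal (exp (- a x))) = M"
proof -
  have "ennreal (exp s) * ennreal (exp (- s)) = 1" for s :: real
    by (simp flip: ennreal_mult exp_add)
  then show ?thesis
    by (simp add: density_density_eq density_1)
qed

lemma rel_entropy_density_exp:
  assumes "prob_space M" and [measurable]: "a \<in> borel_measurable M"
  defines "N \<equiv> density M (\<lambda>x. ennreal (exp (a x)))"
  shows "rel_entropy N M = ereal_integral N a"
proof -
  interpret prob_space M by fact
  have "AE x in M. ennreal (exp (a x)) = RN_deriv M N x"
    by (rule RN_deriv_unique) (simp_all add: N_def)
  then have "AE x in N. ln (enn2real (RN_deriv M N x)) = a x"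
  proof -
    have "AE x in M. 0 < ennreal (exp (a x)) \<longrightarrow> ln (enn2real (RN_deriv M N x)) = a x"
      using \<open>AE x in M. ennreal (exp (a x)) = RN_deriv M N x\<close> by eventually_elim (drule sym, simp)
    then have "AE x in density M (\<lambda>x. ennreal (exp (a x))). ln (enn2real (RN_deriv M N x)) = a x"
      by (subst AE_density) auto
    then show ?thesis
      by (simp only: N_def)
  qed
  then have "ereal_integral N (\<lambda>x. ln (enn2real (RN_deriv M N x))) = ereal_integral N a"
    unfolding ereal_integral_def
    by (intro arg_cong2[where f = "(-)"] arg_cong[where f = enn2ereal] nn_integral_cong_AE) auto
  then show ?thesis
    by (simp add: rel_entropy_def N_def absolutely_continuousI_density)
qed

text \<open>By \<open>density_exp_cancel\<close>, \<open>M\<close> is the density with exponent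
  \<open>- a\<close> over the tilted measure, so the roles in \<open>rel_entropy_density_exp\<close>
  can be exchanged.\<close>

lemma rel_entropy_density_exp':
  assumes [measurable]: "a \<in> borel_measurable M"
    and "prob_space (density M (\<lambda>x. ennreal (exp (a x))))"
  shows "rel_entropy M (density M (\<lambda>x. ennreal (exp (a x)))) = ereal_integral M (\<lambda>x. - a x)"
  using rel_entropy_density_exp[OF assms(2), of "\<lambda>x. - a x"] by (simp add: density_exp_cancel)

text \<open>Mutual absolute continuity makes the density finite and positive almost everywhere, so
  its logarithm can be taken as a real function.\<close>

lemma ex_density_exp:
  assumes "prob_space M" "prob_space N" "sets N = sets M"
    and "absolutely_continuous M N" "absolutely_continuous N M"
  obtains a where "a \<in> borel_measurable M" "N = density M (\<lambda>x. ennreal (exp (a x)))"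
proof -
  interpret M: prob_space M by fact
  interpret N: prob_space N by fact
  obtain D where [measurable]: "D \<in> borel_measurable M"
    and D: "AE x in M. RN_deriv M N x = ennreal (D x)" "AE x in N. 0 < D x"
    using M.real_RN_deriv[OF N.finite_measure_axioms assms(4,3)] by metis
  have "AE x in M. 0 < D x"
    using absolutely_continuous_AE[OF assms(3)[symmetric] assms(5) D(2)] .
  with D(1) have "AE x in M. RN_deriv M N x = ennreal (exp (ln (D x)))"
    by eventually_elim simp
  then have "density M (RN_deriv M N) = density M (\<lambda>x. ennreal (exp (ln (D x))))"
    by (intro density_cong) auto
  then show thesis
    using M.density_RN_deriv[OF assms(4,3)] by (intro that[of "\<lambda>x. ln (D x)"]) auto
qed

text \<open>Formally the left-hand side is the integral of \<open>a\<close> against \<open>N\<close>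
  minus that against \<open>M\<close>. The subtracted parts \<open>N1\<close> and \<open>N2\<close>
  are always finite, so no indeterminate difference arises, and both sides may be infinite.\<close>

lemma rel_entropy_symmetric:
  assumes "prob_space M" and [measurable]: "a \<in> borel_measurable M"
  defines "N \<equiv> density M (\<lambda>x. ennreal (exp (a x)))"
  assumes "prob_space N"
  shows "rel_entropy N M + rel_entropy M N
    = enn2ereal (\<integral>\<^sup>+ x. ennreal (a x * (exp (a x) - 1)) \<partial>M)"
proof -
  interpret M: prob_space M by fact
  interpret N: prob_space N by fact
  define P1 where "P1 = (\<integral>\<^sup>+ x. ennreal (exp (a x)) * ennreal (a x) \<partial>M)"
  define N1 where "N1 = (\<integral>\<^sup>+ x. ennreal (exp (a x)) * ennreal (- a x) \<partial>M)"
  define P2 where "P2 = (\<integral>\<^sup>+ x. ennreal (- a x) \<partial>M)"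
  define N2 where "N2 = (\<integral>\<^sup>+ x. ennreal (a x) \<partial>M)"
  define S where "S = (\<integral>\<^sup>+ x. ennreal (a x * (exp (a x) - 1)) \<partial>M)"
  have "rel_entropy N M = enn2ereal P1 - enn2ereal N1"
    using rel_entropy_density_exp[OF assms(1,2)]
    by (simp add: ereal_integral_def N_def P1_def N1_def nn_integral_density)
  moreover have "rel_entropy M N = enn2ereal P2 - enn2ereal N2"
    using rel_entropy_density_exp'[OF assms(2)] assms(4)
    by (simp add: ereal_integral_def N_def P2_def N2_def)
  moreover have "N1 \<noteq> \<infinity>"
  proof -
    have "exp s * (- s) \<le> 1" for s :: real
      using mult_right_mono[of "- s" "exp (- s)" "exp s"] exp_ge_add_one_self[of "- s"]
      by (simp add: mult.commute flip: exp_add)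
    then have "N1 \<le> (\<integral>\<^sup>+ x. 1 \<partial>M)"
      unfolding N1_def by (intro nn_integral_mono) (simp flip: ennreal_mult' add: ennreal_le_1)
    then show ?thesis
      by (auto simp: M.emeasure_space_1 top_unique)
  qed
  moreover have "N2 \<noteq> \<infinity>"
  proof -
    have "N2 \<le> (\<integral>\<^sup>+ x. ennreal (exp (a x)) \<partial>M)"
      unfolding N2_def
      by (intro nn_integral_mono ennreal_leI order_trans[OF _ exp_ge_add_one_self]) simp
    also have "\<dots> = emeasure N (space N)"
      by (simp add: N_def emeasure_density cong: nn_integral_cong)
    finally show ?thesis
      using N.emeasure_space_1 by (auto simp: top_unique)
  qed
  \<comment> \<open>The subtracted parts are moved to the other side, which leaves a pointwise
    identity between nonnegative terms.\<close>
  moreover have "S + (N1 + N2) = P1 + P2"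
  proof -
    have "ennreal (s * (exp s - 1)) + (ennreal (exp s) * ennreal (- s) + ennreal s)
        = ennreal (exp s) * ennreal s + ennreal (- s)" for s :: real
    proof (cases "0 \<le> s")
      case True
      then show ?thesis
        by (simp add: ennreal_neg flip: ennreal_mult ennreal_plus) (simp add: algebra_simps)
    next
      case False
      then have "0 \<le> s * (exp s - 1)" "s \<le> 0"
        by (simp_all add: mult_nonpos_nonpos)
      moreover have "ennreal (s * (exp s - 1)) + ennreal (- (s * exp s))
          = ennreal (s * (exp s - 1) + - (s * exp s))"
        using calculation by (intro ennreal_plus[symmetric]) (auto simp: mult_le_0_iff)
      ultimately show ?thesis
        by (simp add: ennreal_neg flip: ennreal_mult') (simp add: algebra_simps)
    qed
    then show ?thesis
      by (simp add: S_def P1_def P2_def N1_def N2_def flip: nn_integral_add)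
  qed
  ultimately show ?thesis
    unfolding S_def[symmetric]
    by (cases S; cases P1; cases P2; cases N1; cases N2)
      (auto simp flip: ennreal_plus)
qed

section \<open>Clipped potentials\<close>

definition clip :: "real \<Rightarrow> real \<Rightarrow> real" where
  "clip r x = max (- r) (min r x)"

lemma measurable_clip [measurable]: "clip r \<in> borel_measurable borel"
  unfolding clip_def by measurable

lemma abs_clip_le: "0 \<le> r \<Longrightarrow> \<bar>clip r x\<bar> \<le> r" "0 \<le> r \<Longrightarrow> \<bar>clip r x\<bar> \<le> \<bar>x\<bar>"
  by (auto simp: clip_def)

lemma eventually_clip: "\<forall>\<^sub>F n in sequentially. clip (real n) x = x"
proof -
  have "\<forall>\<^sub>F n in sequentially. \<bar>x\<bar> \<le> real n"
    by real_asymp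
  then show ?thesis
    by eventually_elim (auto simp: clip_def)
qed

text \<open>If \<open>0 \<le> x + y\<close> then \<open>x \<ge> - y\<close>, and since clipping is
  monotone and odd, \<open>clip r x \<ge> - clip r y\<close>; the other sign is symmetric. Hence the
  two summands may be clipped separately.\<close>

lemma clip_add_sign: "0 \<le> r \<Longrightarrow> 0 \<le> (clip r x + clip r y) * (exp (x + y) - 1)"
proof (cases "0 \<le> x + y")
  assume "0 \<le> r"
  case True
  with \<open>0 \<le> r\<close> have "0 \<le> clip r x + clip r y"
    by (auto simp: clip_def)
  with True show ?thesis by simp
next
  assume "0 \<le> r"
  case False
  with \<open>0 \<le> r\<close> have "clip r x + clip r y \<le> 0"
    by (auto simp: clip_def)
  with False show ?thesis by (simp add: mult_nonpos_nonpos)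
qed

lemma stab_const_nonneg:
  assumes "prob_space M" and [measurable]: "f \<in> borel_measurable M"
  shows "0 \<le> stab_const M f"
  unfolding stab_const_def
proof (rule INF_greatest)
  interpret prob_space M by fact
  fix \<alpha> :: real assume \<alpha>: "\<alpha> \<in> {0<..}"
  define K where "K = (\<integral>\<^sup>+ x. ennreal (exp (\<alpha> * \<bar>f x\<bar>)) \<partial>M)"
  have "(\<integral>\<^sup>+ x. 1 \<partial>M) \<le> K"
    unfolding K_def using \<alpha> by (intro nn_integral_mono) simp
  then have "1 \<le> K"
    by (simp add: emeasure_space_1)
  then have "0 \<le> ln_enn K"
    by (cases K) (auto simp: ln_enn_def simp flip: ennreal_1)
  then have "0 \<le> ereal (3 / 2) + ln_enn K"
    by (intro add_nonneg_nonneg) simp_all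
  then show "0 \<le> ereal (2 / \<alpha>) *
      (ereal (3 / 2) + ln_enn (\<integral>\<^sup>+ x. ennreal (exp (\<alpha> * \<bar>f x\<bar>)) \<partial>M))"
    using \<alpha> by (simp flip: K_def)
qed

text \<open>
  Here \<open>\<infinity> * 0 = 0\<close>, so an infinite constant is harmless when the marginals agree.
\<close>

definition marginal_bound :: "ereal \<Rightarrow> ereal \<Rightarrow> ereal \<Rightarrow> ereal" where
  "marginal_bound C H H' = C * sqrt_ereal H + (1 + C / 2) * H + H'"

text \<open>Allows the main estimate to assume a finite bound: this makes the entropies finite, and
  also \<open>C\<close> unless \<open>H = 0\<close>.\<close>

lemma marginal_bound_cases:
  assumes "0 \<le> C" "0 \<le> H" "0 \<le> H'"
  shows "0 \<le> marginal_bound C H H'"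
    and "H = \<infinity> \<or> H' = \<infinity> \<or> C = \<infinity> \<and> H \<noteq> 0 \<Longrightarrow> marginal_bound C H H' = \<infinity>"
  using assms
  by (cases C; cases H; cases H'; auto simp: marginal_bound_def sqrt_ereal_def one_ereal_def zero_ereal_def)+

text \<open>The limit is the integral of \<open>(f + a) * (exp a - 1)\<close> against
  \<open>M\<close>. The part with \<open>a\<close> gives the sum of the two entropies; the part with
  \<open>f\<close> is at most \<open>C * (sqrt H + H / 2)\<close> by
  \<open>weighted_Pinsker\<close>, optimised over \<alpha>. Regrouped, this is
  \<open>marginal_bound\<close>.\<close>

lemma marginal_limit:
  fixes a f :: "'a \<Rightarrow> real"
  assumes "prob_space M" and [measurable]: "a \<in> borel_measurable M" "f \<in> borel_measurable M"
  defines "N \<equiv> density M (\<lambda>x. ennreal (exp (a x)))"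
  assumes "prob_space N"
  defines "R \<equiv> marginal_bound (stab_const M f) (rel_entropy N M) (rel_entropy M N)"
  assumes R_finite: "R \<noteq> \<infinity>"
  obtains l where
    "(\<lambda>n. (\<integral>x. clip (real n) (f x + a x) \<partial>N) - (\<integral>x. clip (real n) (f x + a x) \<partial>M)) \<longlonglongrightarrow> l"
    "ereal l \<le> R"
proof -
  interpret M: prob_space M by fact
  interpret N: prob_space N by fact
  have [simp]: "sets N = sets M"
    by (simp add: N_def)
  have [measurable]: "a \<in> borel_measurable N" "f \<in> borel_measurable N"
    by (simp_all add: N_def)
  define C where "C = stab_const M f"
  have C: "0 \<le> C"
    unfolding C_def by (rule stab_const_nonneg) fact+
  have entropies: "0 \<le> rel_entropy N M" "0 \<le> rel_entropy M N"
    by (intro rel_entropy_nonneg assms)+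
  have fin: "rel_entropy N M \<noteq> \<infinity>" "rel_entropy M N \<noteq> \<infinity>" "C = \<infinity> \<Longrightarrow> rel_entropy N M = 0"
    using marginal_bound_cases(2)[OF C entropies] R_finite unfolding R_def C_def by blast+
  have "rel_entropy N M = ereal_integral N a"
    using rel_entropy_density_exp[OF \<open>prob_space M\<close>, of a] by (simp add: N_def)
  then have ent_N: "integrable N a" "rel_entropy N M = ereal (\<integral>x. a x \<partial>N)"
    using entropies(1) fin(1) ereal_integral_finite[of a N] by simp_all
  have "rel_entropy M N = ereal_integral M (\<lambda>x. - a x)"
    using rel_entropy_density_exp'[of a M] \<open>prob_space N\<close> by (simp add: N_def)
  then have "integrable M (\<lambda>x. - a x)" "rel_entropy M N = ereal (\<integral>x. - a x \<partial>M)"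
    using entropies(2) fin(2) ereal_integral_finite[of "\<lambda>x. - a x" M] by simp_all
  then have ent_M: "integrable M a" "rel_entropy M N = ereal (- (\<integral>x. a x \<partial>M))"
    by simp_all
  define H where "H = (\<integral>x. a x \<partial>N)"
  define H' where "H' = - (\<integral>x. a x \<partial>M)"
  have HH': "0 \<le> H" "0 \<le> H'"
    using entropies by (simp_all add: H_def H'_def ent_N ent_M)
  have int_exp: "integrable M (\<lambda>x. exp (a x))" "(\<integral>x. exp (a x) \<partial>M) = 1"
    using integrable_density[of "\<lambda>_. 1 :: real" M "\<lambda>x. exp (a x)"]
      integral_density[of "\<lambda>_. 1 :: real" M "\<lambda>x. exp (a x)"] N.prob_space
    by (simp_all flip: N_def)
  have int_ent: "integrable M (\<lambda>x. exp (a x) * ln (exp (a x)))"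
      "(\<integral>x. exp (a x) * ln (exp (a x)) \<partial>M) = H"
    using ent_N(1) integrable_density[of a M "\<lambda>x. exp (a x)"] integral_density[of a M "\<lambda>x. exp (a x)"]
    by (simp_all add: H_def flip: N_def)
  note Pinsker = weighted_Pinsker[OF \<open>prob_space M\<close>, of "\<lambda>x. exp (a x)",
      OF _ _ _ _ int_exp int_ent(1), unfolded int_ent(2)]
  define I where "I = (\<lambda>n. (\<integral>x. clip (real n) (f x + a x) \<partial>N) - (\<integral>x. clip (real n) (f x + a x) \<partial>M))"
  have I_eq: "I n = (\<integral>x. clip (real n) (f x + a x) * (exp (a x) - 1) \<partial>M)" for n
  proof -
    have clip_M: "integrable M (\<lambda>x. clip (real n) (f x + a x))"
      by (rule M.integrable_const_bound[of _ "real n"]) (auto intro!: AE_I2 abs_clip_le(1))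
    have "integrable N (\<lambda>x. clip (real n) (f x + a x))"
      by (rule N.integrable_const_bound[of _ "real n"]) (auto intro!: AE_I2 abs_clip_le(1))
    then have "integrable M (\<lambda>x. exp (a x) * clip (real n) (f x + a x))"
      by (simp add: N_def integrable_density)
    with clip_M show ?thesis
      by (simp add: I_def N_def integral_density algebra_simps flip: Bochner_Integration.integral_diff)
  qed
  have "\<exists>l. I \<longlonglongrightarrow> l \<and> ereal l \<le> R"
  proof (cases "H = 0")
    case True
    \<comment> \<open>Now \<open>M\<close> and \<open>N\<close> agree, and \<open>I\<close> vanishes whether or not \<open>f\<close> is integrable.\<close>
    have "integrable M (\<lambda>x. \<bar>exp (a x) - 1\<bar>)" "(\<integral>x. \<bar>exp (a x) - 1\<bar> \<partial>M) \<le> 0"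
      using Pinsker[of "\<lambda>_. 1"] True by simp_all
    then have "(\<integral>x. \<bar>exp (a x) - 1\<bar> \<partial>M) = 0"
      by (intro antisym integral_nonneg) auto
    then have "AE x in M. \<bar>exp (a x) - 1\<bar> = 0"
      using \<open>integrable M (\<lambda>x. \<bar>exp (a x) - 1\<bar>)\<close>
      by (subst integral_nonneg_eq_0_iff_AE[symmetric]) auto
    then have "I n = 0" for n
      unfolding I_eq by (intro integral_eq_zero_AE) (auto elim!: eventually_mono)
    moreover have "0 \<le> R"
      using marginal_bound_cases(1)[OF C entropies] by (simp add: R_def C_def)
    ultimately have "I \<longlonglongrightarrow> 0 \<and> ereal 0 \<le> R"
      by (simp add: LIMSEQ_def zero_ereal_def[symmetric])
    then show ?thesis
      by blast
  next
    case False
    then have "0 < H"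
      using HH' by simp
    define X where "X = (\<integral>x. \<bar>f x\<bar> * \<bar>exp (a x) - 1\<bar> \<partial>M)"
    define J where "J = (\<lambda>\<alpha>. ereal (2 / \<alpha>) *
      (ereal (3 / 2) + ln_enn (\<integral>\<^sup>+ x. ennreal (exp (\<alpha> * \<bar>f x\<bar>)) \<partial>M)))"
    have C_eq: "C = (INF \<alpha>\<in>{0<..}. J \<alpha>)"
      by (simp add: C_def stab_const_def J_def)
    have "C \<noteq> \<infinity>"
      using fin(3) \<open>0 < H\<close> by (auto simp: ent_N(2) H_def[symmetric])
    then obtain c where c: "C = ereal c" "0 \<le> c"
      using C by (cases C) auto
    \<comment> \<open>\<open>weighted_Pinsker\<close> with weight
      \<open>\<alpha> / 2 * \<bar>f x\<bar>\<close>, whose doubled exponent is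
      \<open>\<alpha> * \<bar>f x\<bar>\<close>; undoing the scaling produces the prefactor
      \<open>2 / \<alpha>\<close>. Dividing by the positive \<open>sqrt H + H / 2\<close> puts the
      bound in a form that passes to the infimum.\<close>
    have J: "integrable M (\<lambda>x. \<bar>f x\<bar> * \<bar>exp (a x) - 1\<bar>) \<and> ereal (X / (sqrt H + H / 2)) \<le> J \<alpha>"
      if "0 < \<alpha>" "J \<alpha> \<noteq> \<infinity>" for \<alpha>
    proof -
      define K where "K = (\<integral>x. exp (2 * (\<alpha> / 2 * \<bar>f x\<bar>)) \<partial>M)"
      have "(\<integral>\<^sup>+ x. ennreal (exp (\<alpha> * \<bar>f x\<bar>)) \<partial>M) \<noteq> \<infinity>"
        using that by (auto simp: J_def ln_enn_def)
      then have int: "integrable M (\<lambda>x. exp (2 * (\<alpha> / 2 * \<bar>f x\<bar>)))"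
        by (intro integrableI_nonneg) (auto simp: less_top)
      have "(\<integral>\<^sup>+ x. ennreal (exp (\<alpha> * \<bar>f x\<bar>)) \<partial>M) = ennreal K"
        using nn_integral_eq_integral[OF int] by (simp add: K_def)
      moreover have "0 \<le> K"
        by (simp add: K_def)
      ultimately have J_eq: "J \<alpha> = ereal (2 / \<alpha> * (3 / 2 + ln K))"
        by (simp add: J_def ln_enn_def)
      have P: "integrable M (\<lambda>x. \<alpha> / 2 * \<bar>f x\<bar> * \<bar>exp (a x) - 1\<bar>)"
        "(\<integral>x. \<alpha> / 2 * \<bar>f x\<bar> * \<bar>exp (a x) - 1\<bar> \<partial>M) \<le> (3 / 2 + ln K) * (sqrt H + H / 2)"
        unfolding K_def using that int by (intro Pinsker; simp)+
      have "integrable M (\<lambda>x. 2 / \<alpha> * (\<alpha> / 2 * \<bar>f x\<bar> * \<bar>exp (a x) - 1\<bar>))"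
        using P(1) by (rule integrable_mult_right)
      then have int': "integrable M (\<lambda>x. \<bar>f x\<bar> * \<bar>exp (a x) - 1\<bar>)"
        using that by simp
      then have "\<alpha> / 2 * X \<le> (3 / 2 + ln K) * (sqrt H + H / 2)"
        using P(2) by (simp add: X_def mult.assoc)
      then have "2 / \<alpha> * (\<alpha> / 2 * X) \<le> 2 / \<alpha> * ((3 / 2 + ln K) * (sqrt H + H / 2))"
        using that by (intro mult_left_mono) simp_all
      also have "2 / \<alpha> * (\<alpha> / 2 * X) = X"
        using that by simp
      finally have "X \<le> 2 / \<alpha> * (3 / 2 + ln K) * (sqrt H + H / 2)"
        by (simp only: mult.assoc)
      moreover have "0 < sqrt H + H / 2"
        using \<open>0 < H\<close> by (simp add: add_pos_pos)
      ultimately have "X / (sqrt H + H / 2) \<le> 2 / \<alpha> * (3 / 2 + ln K)"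
        by (simp only: pos_divide_le_eq)
      then show ?thesis
        using int' J_eq by simp
    qed
    \<comment> \<open>One admissible \<alpha> is enough for integrability, which does not depend on
      \<alpha>.\<close>
    have "\<exists>\<alpha>>0. J \<alpha> \<noteq> \<infinity>"
    proof (rule ccontr)
      assume "\<not> (\<exists>\<alpha>>0. J \<alpha> \<noteq> \<infinity>)"
      then have "\<infinity> \<le> C"
        unfolding C_eq by (intro INF_greatest) auto
      with \<open>C \<noteq> \<infinity>\<close> show False by simp
    qed
    with J have int_f: "integrable M (\<lambda>x. \<bar>f x\<bar> * \<bar>exp (a x) - 1\<bar>)"
      by blast
    have "ereal (X / (sqrt H + H / 2)) \<le> C"
      unfolding C_eq
    proof (rule INF_greatest)
      fix \<alpha> :: real assume "\<alpha> \<in> {0<..}"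
      then show "ereal (X / (sqrt H + H / 2)) \<le> J \<alpha>"
        using J[of \<alpha>] by (cases "J \<alpha> = \<infinity>") auto
    qed
    then have X_le: "X \<le> c * (sqrt H + H / 2)"
      using \<open>0 < H\<close> by (simp add: c add_pos_pos pos_divide_le_eq)
    have int_f': "integrable M (\<lambda>x. f x * (exp (a x) - 1))"
      by (rule Bochner_Integration.integrable_bound[OF int_f]) (auto simp: abs_mult)
    have int_a: "integrable M (\<lambda>x. a x * (exp (a x) - 1))"
      using int_ent(1) ent_M(1) by (simp add: algebra_simps)
    have lim: "I \<longlonglongrightarrow> (\<integral>x. (f x + a x) * (exp (a x) - 1) \<partial>M)"
      unfolding I_eq[abs_def]
    proof (rule integral_dominated_convergence)
      show "integrable M (\<lambda>x. \<bar>f x * (exp (a x) - 1)\<bar> + \<bar>a x * (exp (a x) - 1)\<bar>)"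
        using int_f' int_a by simp
      show "AE x in M. (\<lambda>n. clip (real n) (f x + a x) * (exp (a x) - 1))
          \<longlonglongrightarrow> (f x + a x) * (exp (a x) - 1)"
      proof (intro AE_I2 tendsto_eventually)
        show "\<forall>\<^sub>F n in sequentially.
            clip (real n) (f x + a x) * (exp (a x) - 1) = (f x + a x) * (exp (a x) - 1)" for x
          using eventually_clip[of "f x + a x"] by eventually_elim simp
      qed
      fix n
      have "\<bar>clip (real n) (s + t) * w\<bar> \<le> \<bar>s * w\<bar> + \<bar>t * w\<bar>" for s t w :: real
      proof -
        have "\<bar>clip (real n) (s + t)\<bar> \<le> \<bar>s\<bar> + \<bar>t\<bar>"
          using abs_clip_le(2)[of n "s + t"] by simp
        then show ?thesis
          by (simp add: abs_mult mult_right_mono flip: distrib_right)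
      qed
      then show "AE x in M. norm (clip (real n) (f x + a x) * (exp (a x) - 1))
          \<le> \<bar>f x * (exp (a x) - 1)\<bar> + \<bar>a x * (exp (a x) - 1)\<bar>"
        by simp
    qed measurable
    have "(\<integral>x. (f x + a x) * (exp (a x) - 1) \<partial>M)
        = (\<integral>x. f x * (exp (a x) - 1) \<partial>M) + (\<integral>x. a x * (exp (a x) - 1) \<partial>M)"
      using int_f' int_a by (simp add: distrib_right)
    \<comment> \<open>The factor \<open>exp (a x)\<close> turns integration against \<open>M\<close>
      into integration against \<open>N\<close>.\<close>
    also have "(\<integral>x. a x * (exp (a x) - 1) \<partial>M) = H + H'"
      using int_ent ent_M(1) by (simp add: H'_def algebra_simps)
    also have "(\<integral>x. f x * (exp (a x) - 1) \<partial>M) \<le> X"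
      unfolding X_def using int_f' int_f
      by (intro integral_mono) (auto simp flip: abs_mult)
    also note X_le
    finally have "ereal (\<integral>x. (f x + a x) * (exp (a x) - 1) \<partial>M)
        \<le> ereal (c * (sqrt H + H / 2) + (H + H'))"
      by simp
    also have "\<dots> = R"
      by (simp add: R_def marginal_bound_def C_def[symmetric] c ent_N(2) ent_M(2) H_def[symmetric] H'_def[symmetric]
          sqrt_ereal_def one_ereal_def algebra_simps)
    finally show ?thesis
      using lim by blast
  qed
  then show thesis
    using that by (auto simp: I_def)
qed

section \<open>The stability estimate\<close>

text \<open>Bounded clipped summands can be integrated one by one, so the clipped integral depends
  on the couplings only through their marginals. Fatou's lemma then needs just the two marginal
  limits.\<close>

lemma rel_entropy_symmetric_le:
  fixes F :: "'a \<Rightarrow> real" and G :: "'b \<Rightarrow> real"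
  assumes "prob_space \<pi>" and [measurable_cong]: "sets \<pi> = sets (\<mu> \<Otimes>\<^sub>M \<nu>)"
    and [measurable]: "F \<in> borel_measurable \<mu>" "G \<in> borel_measurable \<nu>"
    and \<pi>': "\<pi>' = density \<pi> (\<lambda>z. ennreal (exp (F (fst z) + G (snd z))))" "prob_space \<pi>'"
    and marg: "distr \<pi> \<mu> fst = \<mu>" "distr \<pi> \<nu> snd = \<nu>"
    and marg': "distr \<pi>' \<mu> fst = \<mu>'" "distr \<pi>' \<nu> snd = \<nu>'"
    and lim_F: "(\<lambda>n. (\<integral>x. clip (real n) (F x) \<partial>\<mu>') - (\<integral>x. clip (real n) (F x) \<partial>\<mu>)) \<longlonglongrightarrow> l\<^sub>1"
    and lim_G: "(\<lambda>n. (\<integral>y. clip (real n) (G y) \<partial>\<nu>') - (\<integral>y. clip (real n) (G y) \<partial>\<nu>)) \<longlonglongrightarrow> l\<^sub>2"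
  shows "rel_entropy \<pi>' \<pi> + rel_entropy \<pi> \<pi>' \<le> enn2ereal (ennreal (l\<^sub>1 + l\<^sub>2))"
proof -
  interpret P: prob_space \<pi> by fact
  interpret P': prob_space \<pi>' by fact
  define u where "u = (\<lambda>z. F (fst z) + G (snd z))"
  define w where "w = (\<lambda>n z. clip (real n) (F (fst z)) + clip (real n) (G (snd z)))"
  have [measurable]: "u \<in> borel_measurable \<pi>" "w n \<in> borel_measurable \<pi>" for n
    by (simp_all add: u_def w_def)
  have [measurable_cong]: "sets \<pi>' = sets (\<mu> \<Otimes>\<^sub>M \<nu>)"
    using assms(2) by (simp add: \<pi>')
  have \<pi>'_u: "\<pi>' = density \<pi> (\<lambda>z. ennreal (exp (u z)))"
    by (simp add: \<pi>' u_def)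
  have int_F: "integrable \<pi> (\<lambda>z. clip (real n) (F (fst z)))" "integrable \<pi>' (\<lambda>z. clip (real n) (F (fst z)))" for n
    by (rule P.integrable_const_bound[of _ "real n"] P'.integrable_const_bound[of _ "real n"];
        auto intro!: AE_I2 abs_clip_le(1))+
  have int_G: "integrable \<pi> (\<lambda>z. clip (real n) (G (snd z)))" "integrable \<pi>' (\<lambda>z. clip (real n) (G (snd z)))" for n
    by (rule P.integrable_const_bound[of _ "real n"] P'.integrable_const_bound[of _ "real n"];
        auto intro!: AE_I2 abs_clip_le(1))+
  have int_w: "integrable \<pi> (w n)" "integrable \<pi> (\<lambda>z. exp (u z) * w n z)" for n
  proof -
    show "integrable \<pi> (w n)"
      unfolding w_def using int_F int_G by simp
    have "integrable \<pi>' (w n)"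
      unfolding w_def using int_F int_G by simp
    then show "integrable \<pi> (\<lambda>z. exp (u z) * w n z)"
      by (simp add: \<pi>'_u integrable_density)
  qed
  define I where "I = (\<lambda>n. ((\<integral>x. clip (real n) (F x) \<partial>\<mu>') - (\<integral>x. clip (real n) (F x) \<partial>\<mu>))
    + ((\<integral>y. clip (real n) (G y) \<partial>\<nu>') - (\<integral>y. clip (real n) (G y) \<partial>\<nu>)))"
  have I_eq: "(\<integral>\<^sup>+ z. ennreal (w n z * (exp (u z) - 1)) \<partial>\<pi>) = ennreal (I n)" for n
  proof -
    have "(\<integral>x. clip (real n) (F x) \<partial>\<mu>) = (\<integral>z. clip (real n) (F (fst z)) \<partial>\<pi>)"
      by (subst marg(1)[symmetric]) (simp add: integral_distr)
    moreover have "(\<integral>x. clip (real n) (F x) \<partial>\<mu>') = (\<integral>z. clip (real n) (F (fst z)) \<partial>\<pi>')"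
      by (subst marg'(1)[symmetric]) (simp add: integral_distr)
    moreover have "(\<integral>y. clip (real n) (G y) \<partial>\<nu>) = (\<integral>z. clip (real n) (G (snd z)) \<partial>\<pi>)"
      by (subst marg(2)[symmetric]) (simp add: integral_distr)
    moreover have "(\<integral>y. clip (real n) (G y) \<partial>\<nu>') = (\<integral>z. clip (real n) (G (snd z)) \<partial>\<pi>')"
      by (subst marg'(2)[symmetric]) (simp add: integral_distr)
    ultimately have "I n = (\<integral>z. w n z \<partial>\<pi>') - (\<integral>z. w n z \<partial>\<pi>)"
      using int_F int_G by (simp add: I_def w_def)
    also have "(\<integral>z. w n z \<partial>\<pi>') = (\<integral>z. exp (u z) * w n z \<partial>\<pi>)"
      by (simp add: \<pi>'_u integral_density)
    also have "\<dots> - (\<integral>z. w n z \<partial>\<pi>) = (\<integral>z. w n z * (exp (u z) - 1) \<partial>\<pi>)"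
      using int_w by (simp add: algebra_simps flip: Bochner_Integration.integral_diff)
    finally have "I n = (\<integral>z. w n z * (exp (u z) - 1) \<partial>\<pi>)" .
    moreover have "integrable \<pi> (\<lambda>z. w n z * (exp (u z) - 1))"
      using int_w by (simp add: algebra_simps)
    moreover have "0 \<le> w n z * (exp (u z) - 1)" for z
      unfolding w_def u_def by (rule clip_add_sign) simp
    ultimately show ?thesis
      by (simp add: nn_integral_eq_integral)
  qed
  \<comment> \<open>At each point the clipping is eventually inactive, so the integrands are
    eventually constant in \<open>n\<close>.\<close>
  have "(\<integral>\<^sup>+ z. ennreal (u z * (exp (u z) - 1)) \<partial>\<pi>)
      = (\<integral>\<^sup>+ z. liminf (\<lambda>n. ennreal (w n z * (exp (u z) - 1))) \<partial>\<pi>)"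
  proof (rule nn_integral_cong)
    fix z
    have "\<forall>\<^sub>F n in sequentially. ennreal (w n z * (exp (u z) - 1)) = ennreal (u z * (exp (u z) - 1))"
      using eventually_clip[of "F (fst z)"] eventually_clip[of "G (snd z)"]
      by eventually_elim (simp add: w_def u_def)
    then have "(\<lambda>n. ennreal (w n z * (exp (u z) - 1))) \<longlonglongrightarrow> ennreal (u z * (exp (u z) - 1))"
      by (rule tendsto_eventually)
    then show "ennreal (u z * (exp (u z) - 1)) = liminf (\<lambda>n. ennreal (w n z * (exp (u z) - 1)))"
      by (simp add: lim_imp_Liminf)
  qed
  also have "\<dots> \<le> liminf (\<lambda>n. \<integral>\<^sup>+ z. ennreal (w n z * (exp (u z) - 1)) \<partial>\<pi>)"
    by (rule nn_integral_liminf) measurable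
  also have "\<dots> = liminf (\<lambda>n. ennreal (I n))"
    by (simp add: I_eq)
  also have "\<dots> = ennreal (l\<^sub>1 + l\<^sub>2)"
  proof (rule lim_imp_Liminf)
    show "(\<lambda>n. ennreal (I n)) \<longlonglongrightarrow> ennreal (l\<^sub>1 + l\<^sub>2)"
      unfolding I_def by (intro tendsto_ennrealI tendsto_add lim_F lim_G)
  qed simp
  finally show ?thesis
    using rel_entropy_symmetric[of \<pi> u] \<open>prob_space \<pi>\<close> \<open>prob_space \<pi>'\<close>
    by (simp add: less_eq_ennreal.rep_eq flip: \<pi>'_u)
qed

text \<open>Both couplings carry the same factor \<open>exp (- c)\<close>, which cancels in their
  ratio. What remains has an exponent that is a function of \<open>x\<close> plus a function of
  \<open>y\<close>.\<close>

lemma density_pair_exp: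
  fixes c :: "'a \<times> 'b \<Rightarrow> real"
  assumes "prob_space \<nu>" "prob_space (density \<nu> (\<lambda>y. ennreal (exp (b y))))"
    and [measurable]: "a \<in> borel_measurable \<mu>" "b \<in> borel_measurable \<nu>"
      "\<phi> \<in> borel_measurable \<mu>" "\<psi> \<in> borel_measurable \<nu>"
      "\<phi>' \<in> borel_measurable \<mu>" "\<psi>' \<in> borel_measurable \<nu>" "c \<in> borel_measurable (\<mu> \<Otimes>\<^sub>M \<nu>)"
  shows "density (density \<mu> (\<lambda>x. ennreal (exp (a x))) \<Otimes>\<^sub>M density \<nu> (\<lambda>y. ennreal (exp (b y))))
      (\<lambda>(x, y). ennreal (exp (\<phi>' x + \<psi>' y - c (x, y))))
    = density (density (\<mu> \<Otimes>\<^sub>M \<nu>) (\<lambda>(x, y). ennreal (exp (\<phi> x + \<psi> y - c (x, y)))))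
      (\<lambda>z. ennreal (exp ((\<phi>' (fst z) - \<phi> (fst z) + a (fst z)) + (\<psi>' (snd z) - \<psi> (snd z) + b (snd z)))))"
proof -
  interpret \<nu>: prob_space \<nu> by fact
  interpret \<nu>': prob_space "density \<nu> (\<lambda>y. ennreal (exp (b y)))" by fact
  have "density \<mu> (\<lambda>x. ennreal (exp (a x))) \<Otimes>\<^sub>M density \<nu> (\<lambda>y. ennreal (exp (b y)))
      = density (\<mu> \<Otimes>\<^sub>M \<nu>) (\<lambda>(x, y). ennreal (exp (a x)) * ennreal (exp (b y)))"
    by (rule pair_measure_density) (simp_all add: \<nu>.sigma_finite_measure_axioms \<nu>'.sigma_finite_measure_axioms)
  then show ?thesis
    by (simp add: density_density_eq)
      (intro density_cong AE_I2; auto simp: algebra_simps simp flip: ennreal_mult exp_add)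
qed

theorem theorem3p3:
  fixes c :: "'a::polish_space \<times> 'b::polish_space \<Rightarrow> real"
    and \<mu> \<mu>' :: "'a measure" and \<nu> \<nu>' :: "'b measure"
    and \<pi> \<pi>' :: "('a \<times> 'b) measure"
    and \<phi> \<phi>' :: "'a \<Rightarrow> real" and \<psi> \<psi>' :: "'b \<Rightarrow> real"
  assumes "sets \<mu> = sets borel" "sets \<mu>' = sets borel"
    and "sets \<nu> = sets borel" "sets \<nu>' = sets borel"
    and "prob_space \<mu>" "prob_space \<mu>'" "prob_space \<nu>" "prob_space \<nu>'"
    and "c \<in> borel_measurable (borel \<Otimes>\<^sub>M borel)"
    and "integrable (\<mu> \<Otimes>\<^sub>M \<nu>) (\<lambda>z. exp (- c z))"
    and "integrable (\<mu>' \<Otimes>\<^sub>M \<nu>') (\<lambda>z. exp (- c z))"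
    and "\<bar>eot_cost c \<mu> \<nu>\<bar> \<noteq> \<infinity>" "\<bar>eot_cost c \<mu>' \<nu>'\<bar> \<noteq> \<infinity>"
    and "\<pi> \<in> couplings \<mu> \<nu>"
    and "ereal_integral \<pi> c + rel_entropy \<pi> (\<mu> \<Otimes>\<^sub>M \<nu>) = eot_cost c \<mu> \<nu>"
    and "\<pi>' \<in> couplings \<mu>' \<nu>'"
    and "ereal_integral \<pi>' c + rel_entropy \<pi>' (\<mu>' \<Otimes>\<^sub>M \<nu>') = eot_cost c \<mu>' \<nu>'"
    and "\<phi> \<in> borel_measurable borel" "\<psi> \<in> borel_measurable borel"
    and "\<phi>' \<in> borel_measurable borel" "\<psi>' \<in> borel_measurable borel"
    and "\<pi> = density (\<mu> \<Otimes>\<^sub>M \<nu>) (\<lambda>(x, y). ennreal (exp (\<phi> x + \<psi> y - c (x, y))))"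
    and "\<pi>' = density (\<mu>' \<Otimes>\<^sub>M \<nu>') (\<lambda>(x, y). ennreal (exp (\<phi>' x + \<psi>' y - c (x, y))))"
  shows "rel_entropy \<pi>' \<pi> + rel_entropy \<pi> \<pi>'
         \<le> stab_const \<mu> (\<lambda>x. \<phi>' x - \<phi> x) * sqrt_ereal (rel_entropy \<mu>' \<mu>)
           + (1 + stab_const \<mu> (\<lambda>x. \<phi>' x - \<phi> x) / 2) * rel_entropy \<mu>' \<mu>
           + rel_entropy \<mu> \<mu>'
           + stab_const \<nu> (\<lambda>y. \<psi>' y - \<psi> y) * sqrt_ereal (rel_entropy \<nu>' \<nu>)
           + (1 + stab_const \<nu> (\<lambda>y. \<psi>' y - \<psi> y) / 2) * rel_entropy \<nu>' \<nu>
           + rel_entropy \<nu> \<nu>'"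
proof -
  note [measurable_cong] = assms(1-4)
  note [measurable] = assms(18-21)
  define R\<^sub>1 where "R\<^sub>1 = marginal_bound (stab_const \<mu> (\<lambda>x. \<phi>' x - \<phi> x)) (rel_entropy \<mu>' \<mu>) (rel_entropy \<mu> \<mu>')"
  define R\<^sub>2 where "R\<^sub>2 = marginal_bound (stab_const \<nu> (\<lambda>y. \<psi>' y - \<psi> y)) (rel_entropy \<nu>' \<nu>) (rel_entropy \<nu> \<nu>')"
  have C\<^sub>1: "0 \<le> stab_const \<mu> (\<lambda>x. \<phi>' x - \<phi> x)" and C\<^sub>2: "0 \<le> stab_const \<nu> (\<lambda>y. \<psi>' y - \<psi> y)"
    by (intro stab_const_nonneg assms(5,7); measurable)+
  note entropies = rel_entropy_nonneg[OF assms(5,6)] rel_entropy_nonneg[OF assms(6,5)]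
    rel_entropy_nonneg[OF assms(7,8)] rel_entropy_nonneg[OF assms(8,7)]
  note bound\<^sub>1 = marginal_bound_cases[OF C\<^sub>1 entropies(1,2), folded R\<^sub>1_def]
  note bound\<^sub>2 = marginal_bound_cases[OF C\<^sub>2 entropies(3,4), folded R\<^sub>2_def]
  have "rel_entropy \<pi>' \<pi> + rel_entropy \<pi> \<pi>' \<le> R\<^sub>1 + R\<^sub>2"
  \<comment> \<open>Both bounds are nonnegative, so one infinite bound makes the claim trivial.
    Otherwise all four marginal entropies are finite, which by definition of
    \<open>rel_entropy\<close> gives mutual absolute continuity.\<close>
  proof (cases "R\<^sub>1 = \<infinity> \<or> R\<^sub>2 = \<infinity>")
    case True
    then show ?thesis
      using bound\<^sub>1(1) bound\<^sub>2(1) by auto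
  next
    case False
    then have "rel_entropy \<mu>' \<mu> \<noteq> \<infinity>" "rel_entropy \<mu> \<mu>' \<noteq> \<infinity>"
        "rel_entropy \<nu>' \<nu> \<noteq> \<infinity>" "rel_entropy \<nu> \<nu>' \<noteq> \<infinity>"
      using bound\<^sub>1(2) bound\<^sub>2(2) by blast+
    then have ac: "absolutely_continuous \<mu> \<mu>'" "absolutely_continuous \<mu>' \<mu>"
        "absolutely_continuous \<nu> \<nu>'" "absolutely_continuous \<nu>' \<nu>"
      unfolding rel_entropy_def by (auto split: if_splits)
    obtain a where [measurable]: "a \<in> borel_measurable \<mu>" and \<mu>': "\<mu>' = density \<mu> (\<lambda>x. ennreal (exp (a x)))"
      using ex_density_exp[OF assms(5,6) _ ac(1,2)] assms(1,2) by auto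
    obtain b where [measurable]: "b \<in> borel_measurable \<nu>" and \<nu>': "\<nu>' = density \<nu> (\<lambda>y. ennreal (exp (b y)))"
      using ex_density_exp[OF assms(7,8) _ ac(3,4)] assms(3,4) by auto
    obtain l\<^sub>1 where l\<^sub>1: "ereal l\<^sub>1 \<le> R\<^sub>1"
      "(\<lambda>n. (\<integral>x. clip (real n) (\<phi>' x - \<phi> x + a x) \<partial>\<mu>') - (\<integral>x. clip (real n) (\<phi>' x - \<phi> x + a x) \<partial>\<mu>)) \<longlonglongrightarrow> l\<^sub>1"
      using marginal_limit[of \<mu> a "\<lambda>x. \<phi>' x - \<phi> x"] assms(5,6) False unfolding \<mu>'[symmetric] R\<^sub>1_def[symmetric]
      by auto
    obtain l\<^sub>2 where l\<^sub>2: "ereal l\<^sub>2 \<le> R\<^sub>2"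
      "(\<lambda>n. (\<integral>y. clip (real n) (\<psi>' y - \<psi> y + b y) \<partial>\<nu>') - (\<integral>y. clip (real n) (\<psi>' y - \<psi> y + b y) \<partial>\<nu>)) \<longlonglongrightarrow> l\<^sub>2"
      using marginal_limit[of \<nu> b "\<lambda>y. \<psi>' y - \<psi> y"] assms(7,8) False unfolding \<nu>'[symmetric] R\<^sub>2_def[symmetric]
      by auto
    have "sets (\<mu> \<Otimes>\<^sub>M \<nu>) = sets (borel \<Otimes>\<^sub>M borel)"
      using assms(1,3) by (rule sets_pair_measure_cong)
    then have c: "c \<in> borel_measurable (\<mu> \<Otimes>\<^sub>M \<nu>)"
      using assms(9) by (simp cong: measurable_cong_sets)
    have "\<pi>' = density \<pi> (\<lambda>z. ennreal (exp ((\<phi>' (fst z) - \<phi> (fst z) + a (fst z))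
        + (\<psi>' (snd z) - \<psi> (snd z) + b (snd z)))))"
      unfolding assms(22,23) \<mu>' \<nu>' using c assms(7,8)
      by (intro density_pair_exp) (simp_all flip: \<nu>')
    moreover have "distr \<pi>' \<mu> fst = \<mu>'" "distr \<pi>' \<nu> snd = \<nu>'"
    proof -
      \<comment> \<open>Only the sigma-algebra of the target measure enters \<open>distr\<close>,
        and all marginals carry the Borel one.\<close>
      have "distr \<pi>' \<mu> fst = distr \<pi>' \<mu>' fst" "distr \<pi>' \<nu> snd = distr \<pi>' \<nu>' snd"
        using assms(1-4) by (auto intro: distr_cong)
      then show "distr \<pi>' \<mu> fst = \<mu>'" "distr \<pi>' \<nu> snd = \<nu>'"
        using assms(16) by (auto simp: couplings_def)
    qed
    ultimately have "rel_entropy \<pi>' \<pi> + rel_entropy \<pi> \<pi>' \<le> enn2ereal (ennreal (l\<^sub>1 + l\<^sub>2))"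
      using assms(14,16) l\<^sub>1(2) l\<^sub>2(2)
      by (intro rel_entropy_symmetric_le[where \<mu> = \<mu> and \<nu> = \<nu> and \<mu>' = \<mu>' and \<nu>' = \<nu>'
            and F = "\<lambda>x. \<phi>' x - \<phi> x + a x" and G = "\<lambda>y. \<psi>' y - \<psi> y + b y"])
        (auto simp: couplings_def)
    \<comment> \<open>\<open>ennreal\<close> sends negative reals to 0; the resulting maximum is
      harmless because \<open>R\<^sub>1\<close> and \<open>R\<^sub>2\<close> are
      nonnegative.\<close>
    also have "\<dots> = max 0 (ereal l\<^sub>1 + ereal l\<^sub>2)"
      by (cases "0 \<le> l\<^sub>1 + l\<^sub>2") (auto simp: ennreal_neg max_def zero_ennreal.rep_eq)
    also have "\<dots> \<le> R\<^sub>1 + R\<^sub>2"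
      using l\<^sub>1(1) l\<^sub>2(1) bound\<^sub>1(1) bound\<^sub>2(1) by (intro max.boundedI add_mono add_nonneg_nonneg)
    finally show ?thesis .
  qed
  then show ?thesis
    by (simp add: R\<^sub>1_def R\<^sub>2_def marginal_bound_def add.assoc)
qed

end
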